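(* Let $\lambda\vdash n$. For every $k=3,\dots,n$ and every $T\in SYT(\lambda)$, the filling $\Psi_k(T)$ is again a standard Young tableau of shape $\lambda$.
   Context: Cells of a Ferrers diagram are indexed by (row, column) coordinates $(i,j)$, rows numbered from the bottom and columns from the left; cell $(i,j)$ is the unit square $[j-1,j]\times[i-1,i]$ with lower left-hand corner $(j-1,i-1)$. $SYT(\lambda)$ is the set of fillings of the diagram of $\lambda$ by $1,\dots,n$ increasing left to right in rows and bottom to top in columns; $c(i,j)$ is the content of cell $(i,j)$. Path $\pi(T,k)$: start at the lower left-hand corner of the cell containing $k$. At the lower left-hand corner of a cell $(i,j)$: if $i=1$ or $j=1$ go straight to the origin and stop; otherwise step South one unit if $c(i-1,j)>c(i,j-1)$ and West one unit if $c(i-1,j)<c(i,j-1)$; iterate. If $k$ is in cell $(r,s)$, for each $1\le i\le r-1$ the path crosses the line $y=i-\tfrac12$ at a single abscissa $x_i$; a cell $(i,j)$ with content less than $k$ is below $\pi(T,k)$ if $i\le r-1$ and $j-\tfrac12>x_i$, and above otherwise. Map $\Psi_k$: partition the cells with content less than $k$ into blocks of maximal length of cells with consecutive contents $a,\dots,a+m$ such that the cell containing $a$ is on the same side of $\pi(T,k)$ as $(1,1)$ and the cells containing $a+1,\dots,a+m$ are on the other side. In each block replace the content $a$ by $a+m$ and each content $a+l$ ($1\le l\le m$) by $a+l-1$; other cells unchanged. The result is $\Psi_k(T)$. *)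

theory Defs
  imports "HOL-Analysis.Analysis"
begin

definition partition_of :: "nat \<Rightarrow> nat list \<Rightarrow> bool" where
  "partition_of n la \<longleftrightarrow> sorted_wrt (\<ge>) la \<and> 0 \<notin> set la \<and> sum_list la = n"

(* Cells are (row, column) pairs counted from 1, with row 1 the largest part at the bottom. *)
definition diagram :: "nat list \<Rightarrow> (nat \<times> nat) set" where
  "diagram la = {(i, j). 1 \<le> i \<and> i \<le> length la \<and> 1 \<le> j \<and> j \<le> la ! (i - 1)}"

(* A filling lives on the diagram only; extensionality fixes the irrelevant values outside. *)
definition SYT :: "nat list \<Rightarrow> (nat \<times> nat \<Rightarrow> nat) set" where
  "SYT la = {T \<in> extensional (diagram la).
     bij_betw T (diagram la) {1..sum_list la} \<and>
     (\<forall>i j j'. (i, j) \<in> diagram la \<and> (i, j') \<in> diagram la \<and> j < j' \<longrightarrow> T (i, j) < T (i, j')) \<and>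
     (\<forall>i i' j. (i, j) \<in> diagram la \<and> (i', j) \<in> diagram la \<and> i < i' \<longrightarrow> T (i, j) < T (i', j))}"

definition cell_of :: "nat list \<Rightarrow> (nat \<times> nat \<Rightarrow> nat) \<Rightarrow> nat \<Rightarrow> nat \<times> nat" where
  "cell_of la T c = the_inv_into (diagram la) T c"

definition corner :: "nat \<Rightarrow> nat \<Rightarrow> real \<times> real" where
  "corner i j = (real j - 1, real i - 1)"

(* Vertices of the path from the lower left-hand corner of cell (i, j) to the origin, in
   plane coordinates (abscissa, ordinate).  The case of equal contents does not arise for
   standard tableaux, so the last branch is the West step; rows and columns start at 1,
   so "\<le> 1" means "= 1". *)
function path_vertices :: "(nat \<times> nat \<Rightarrow> nat) \<Rightarrow> nat \<Rightarrow> nat \<Rightarrow> (real \<times> real) list" where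
  "path_vertices T i j = corner i j #
     (if i \<le> 1 \<or> j \<le> 1 then [(0, 0)]
      else if T (i - 1, j) > T (i, j - 1) then path_vertices T (i - 1) j
      else path_vertices T i (j - 1))"
  by pat_completeness auto
termination by (relation "Wellfounded.measure (\<lambda>(T, i, j). i + j)") auto

declare path_vertices.simps [simp del]

definition polyline :: "(real \<times> real) list \<Rightarrow> (real \<times> real) set" where
  "polyline ps = (\<Union>l \<in> {l. Suc l < length ps}. closed_segment (ps ! l) (ps ! Suc l))"

definition tableau_path :: "nat list \<Rightarrow> (nat \<times> nat \<Rightarrow> nat) \<Rightarrow> nat \<Rightarrow> (real \<times> real) set" where
  "tableau_path la T k = (case cell_of la T k of (r, s) \<Rightarrow> polyline (path_vertices T r s))"

definition crossing :: "nat list \<Rightarrow> (nat \<times> nat \<Rightarrow> nat) \<Rightarrow> nat \<Rightarrow> nat \<Rightarrow> real" where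
  "crossing la T k i = (THE x. (x, real i - 1 / 2) \<in> tableau_path la T k)"

(* Only meaningful for cells of content less than k. *)
definition below_path :: "nat list \<Rightarrow> (nat \<times> nat \<Rightarrow> nat) \<Rightarrow> nat \<Rightarrow> nat \<times> nat \<Rightarrow> bool" where
  "below_path la T k = (\<lambda>(i, j).
     i \<le> fst (cell_of la T k) - 1 \<and> real j - 1 / 2 > crossing la T k i)"

definition same_side :: "nat list \<Rightarrow> (nat \<times> nat \<Rightarrow> nat) \<Rightarrow> nat \<Rightarrow> nat \<Rightarrow> bool" where
  "same_side la T k c \<longleftrightarrow> below_path la T k (cell_of la T c) = below_path la T k (1, 1)"

(* run la T k a m: the contents a, ..., a + m form a candidate block, not necessarily maximal. *)
definition run :: "nat list \<Rightarrow> (nat \<times> nat \<Rightarrow> nat) \<Rightarrow> nat \<Rightarrow> nat \<Rightarrow> nat \<Rightarrow> bool" where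
  "run la T k a m \<longleftrightarrow> 1 \<le> a \<and> a + m < k \<and> same_side la T k a \<and>
     (\<forall>l \<in> {1..m}. \<not> same_side la T k (a + l))"

definition block :: "nat list \<Rightarrow> (nat \<times> nat \<Rightarrow> nat) \<Rightarrow> nat \<Rightarrow> nat \<Rightarrow> nat \<Rightarrow> bool" where
  "block la T k a m \<longleftrightarrow> run la T k a m \<and> (\<forall>m'. run la T k a m' \<longrightarrow> m' \<le> m)"

(* Content 1 lies in cell (1, 1), so every content in {1..<k} lies in exactly one block and
   the description is proper there. *)
definition new_content :: "nat list \<Rightarrow> (nat \<times> nat \<Rightarrow> nat) \<Rightarrow> nat \<Rightarrow> nat \<Rightarrow> nat" where
  "new_content la T k c = (THE d. \<exists>a m. block la T k a m \<and>
     (c = a \<and> d = a + m \<or> (\<exists>l \<in> {1..m}. c = a + l \<and> d = a + l - 1)))"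

definition Psi :: "nat list \<Rightarrow> nat \<Rightarrow> (nat \<times> nat \<Rightarrow> nat) \<Rightarrow> nat \<times> nat \<Rightarrow> nat" where
  "Psi la k T = (\<lambda>p. if p \<in> diagram la \<and> T p < k then new_content la T k (T p) else T p)"

end

(* Let c i be the column in which the path descends from row i + 1 to row i, so that the cells
   below the path are the (i, j) with i < r and c i \<le> j.  Psi_k is increasing on each side of
   the path, hence it can only spoil T x < T y if x is on the side of (1, 1), y is on the other
   side, and no content between T x and T y is on the side of (1, 1).  For x left of y in row i
   such a content does exist when x is above the path: it is that of (i + 1, c i - 1), because
   the step South was taken at (i + 1, c i).  For x under y in column j and x below the path it
   is that of (i, j + 1), where the step West along the top of (i, j) was taken at
   (i + 1, j + 1). *)
theory Submission imports Defs begin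

section \<open>The path as a descending staircase, read off at half-integer heights\<close>

section \<open>Crossings of the path\<close>

lemma polyline_singleton [simp]: "polyline [p] = {}"
  by (simp add: polyline_def)

lemma polyline_Cons_Cons: "polyline (p # q # ps) = closed_segment p q \<union> polyline (q # ps)"
proof -
  have "{l. Suc l < length (p # q # ps)} = insert 0 (Suc ` {l. Suc l < length (q # ps)})"
    by (auto simp: image_iff gr0_conv_Suc) (metis not0_implies_Suc Suc_less_eq)
  then show ?thesis
    by (simp add: polyline_def)
qed

lemma path_vertices_eq_Cons: "\<exists>ps. path_vertices T i j = corner i j # ps"
  by (subst path_vertices.simps) blast

lemma mem_vertical_segment_iff:
  fixes a b d x y :: real
  assumes "b \<le> d"
  shows "(x, y) \<in> closed_segment (a, d) (a, b) \<longleftrightarrow> x = a \<and> b \<le> y \<and> y \<le> d"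
proof
  assume "(x, y) \<in> closed_segment (a, d) (a, b)"
  then obtain u where u: "0 \<le> u" "u \<le> 1" "x = (1 - u) * a + u * a" "y = (1 - u) * d + u * b"
    by (auto simp: closed_segment_def)
  have "y = d - u * (d - b)" "y = b + (1 - u) * (d - b)"
    using u by (auto simp: algebra_simps)
  moreover have "0 \<le> u * (d - b)" "0 \<le> (1 - u) * (d - b)"
    using u assms by auto
  ultimately show "x = a \<and> b \<le> y \<and> y \<le> d"
    using u by (auto simp: algebra_simps)
next
  assume *: "x = a \<and> b \<le> y \<and> y \<le> d"
  then have "y \<in> closed_segment d b"
    using assms by (auto simp: closed_segment_eq_real_ivl)
  then obtain u where "0 \<le> u" "u \<le> 1" "y = (1 - u) * d + u * b"
    by (auto simp: closed_segment_def)
  then show "(x, y) \<in> closed_segment (a, d) (a, b)"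
    using * unfolding closed_segment_def by (auto intro!: exI[of _ u] simp: algebra_simps)
qed

lemma horizontal_segment_snd:
  fixes a b d x y :: real
  assumes "(x, y) \<in> closed_segment (a, d) (b, d)"
  shows "y = d"
  using assms by (auto simp: closed_segment_def algebra_simps)

text \<open>A combinatorial encoding of the path that starts at the corner of (r, s). For
  \<open>i < r\<close> the path enters row \<open>i\<close> from above along the left edge of column
  \<open>c i\<close>; \<open>c r\<close> is the start. The clause with \<open>2 \<le> c i\<close> is
  the comparison behind the South step at \<open>(Suc i, c i)\<close>; in column 1 the path runs
  straight down and compares nothing. The last clause collects the West steps along the bottom of
  row \<open>Suc i\<close>; it is not strict because West is the default branch.\<close>

definition descent_columns :: "(nat \<times> nat \<Rightarrow> nat) \<Rightarrow> nat \<Rightarrow> nat \<Rightarrow> (nat \<Rightarrow> nat) \<Rightarrow> bool" where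
  "descent_columns T r s c \<longleftrightarrow> c r = s \<and>
     (\<forall>i. 1 \<le> i \<and> i < r \<longrightarrow> 1 \<le> c i \<and> c i \<le> c (Suc i) \<and>
        (2 \<le> c i \<longrightarrow> T (Suc i, c i - 1) < T (i, c i)) \<and>
        (\<forall>j. c i \<le> j \<and> j < c (Suc i) \<longrightarrow> T (i, Suc j) \<le> T (Suc i, j)))"

text \<open>The path never rises. After a South step the remaining path starts half a unit below the
  height just crossed, so it cannot meet that height again.\<close>

lemma polyline_path_vertices_le:
  assumes "1 \<le> i" "1 \<le> j" "(x, y) \<in> polyline (path_vertices T i j)"
  shows "y \<le> real i - 1"
  using assms
proof (induction T i j rule: path_vertices.induct)
  case (1 T i j)
  consider "i = 1" | "j = 1" "1 < i"
    | "1 < i" "1 < j" "T (i - 1, j) > T (i, j - 1)"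
    | "1 < i" "1 < j" "\<not> T (i - 1, j) > T (i, j - 1)"
    using "1.prems" by linarith
  then show ?case
  proof cases
    case 1
    with "1.prems" show ?thesis
      by (auto simp: path_vertices.simps polyline_Cons_Cons corner_def dest: horizontal_segment_snd)
  next
    case 2
    with "1.prems" show ?thesis
      by (auto simp: path_vertices.simps polyline_Cons_Cons corner_def mem_vertical_segment_iff)
  next
    case 3
    obtain ps where ps: "path_vertices T (i - 1) j = corner (i - 1) j # ps"
      using path_vertices_eq_Cons by blast
    have "path_vertices T i j = corner i j # path_vertices T (i - 1) j"
      using 3 by (subst path_vertices.simps) simp
    then have "polyline (path_vertices T i j) =
        closed_segment (corner i j) (corner (i - 1) j) \<union> polyline (path_vertices T (i - 1) j)"
      by (simp only: ps polyline_Cons_Cons)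
    then consider "(x, y) \<in> closed_segment (corner i j) (corner (i - 1) j)"
      | "(x, y) \<in> polyline (path_vertices T (i - 1) j)"
      using "1.prems" by blast
    then show ?thesis
    proof cases
      case 1
      then show ?thesis
        by (simp add: corner_def mem_vertical_segment_iff)
    next
      case 2
      then have "y \<le> real (i - 1) - 1"
        using "1.IH"(1) 3 by simp
      then show ?thesis
        by simp
    qed
  next
    case 4
    obtain ps where ps: "path_vertices T i (j - 1) = corner i (j - 1) # ps"
      using path_vertices_eq_Cons by blast
    have "path_vertices T i j = corner i j # path_vertices T i (j - 1)"
      using 4 by (subst path_vertices.simps) simp
    then have "polyline (path_vertices T i j) =
        closed_segment (corner i j) (corner i (j - 1)) \<union> polyline (path_vertices T i (j - 1))"
      by (simp only: ps polyline_Cons_Cons)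
    then consider "(x, y) \<in> closed_segment (corner i j) (corner i (j - 1))"
      | "(x, y) \<in> polyline (path_vertices T i (j - 1))"
      using "1.prems" by blast
    then show ?thesis
    proof cases
      case 1
      then show ?thesis
        by (auto simp: corner_def dest: horizontal_segment_snd)
    next
      case 2
      then show ?thesis
        using "1.IH"(2) 4 by simp
    qed
  qed
qed

text \<open>Induction along the path: the columns of the path left after the first step serve again,
  with the value at \<open>r\<close> set to \<open>s\<close>. The equivalence gives existence and
  uniqueness of the crossing at once, as the \<open>THE\<close> in \<open>crossing\<close>
  requires.\<close>

lemma ex_descent_columns:
  assumes "1 \<le> r" "1 \<le> s"
  shows "\<exists>c. descent_columns T r s c \<and> (\<forall>i x. 1 \<le> i \<and> i < r \<longrightarrow>
    ((x, real i - 1 / 2) \<in> polyline (path_vertices T r s) \<longleftrightarrow> x = real (c i) - 1))"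
  using assms
proof (induction T r s rule: path_vertices.induct)
  case (1 T r s)
  consider "r = 1" | "s = 1" "1 < r"
    | "1 < r" "1 < s" "T (r - 1, s) > T (r, s - 1)"
    | "1 < r" "1 < s" "\<not> T (r - 1, s) > T (r, s - 1)"
    using "1.prems" by linarith
  then show ?case
  proof cases
    case 1
    \<comment> \<open>In row 1 there is no descent, so only the value at \<open>r\<close>
      matters.\<close>
    then show ?thesis
      by (intro exI[of _ "\<lambda>_. s"]) (simp add: descent_columns_def)
  next
    case 2
    have "(x, real i - 1 / 2) \<in> polyline (path_vertices T r s) \<longleftrightarrow> x = 0" if "1 \<le> i" "i < r" for i x
      using 2 that
      by (auto simp: path_vertices.simps polyline_Cons_Cons corner_def mem_vertical_segment_iff)
    \<comment> \<open>The path runs down the left border, and both kinds of comparison are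
      vacuous.\<close>
    with 2 show ?thesis
      by (intro exI[of _ "\<lambda>_. 1"]) (simp add: descent_columns_def)
  next
    case 3
    obtain ps where ps: "path_vertices T (r - 1) s = corner (r - 1) s # ps"
      using path_vertices_eq_Cons by blast
    have "path_vertices T r s = corner r s # path_vertices T (r - 1) s"
      using 3 by (subst path_vertices.simps) simp
    then have poly: "polyline (path_vertices T r s) =
        closed_segment (corner r s) (corner (r - 1) s) \<union> polyline (path_vertices T (r - 1) s)"
      by (simp only: ps polyline_Cons_Cons)
    have IH_prems: "\<not> (r \<le> 1 \<or> s \<le> 1)" "1 \<le> r - 1"
      using 3 by linarith+
    obtain c where c: "descent_columns T (r - 1) s c"
      and cross: "\<And>i x. 1 \<le> i \<Longrightarrow> i < r - 1 \<Longrightarrow>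
        (x, real i - 1 / 2) \<in> polyline (path_vertices T (r - 1) s) \<longleftrightarrow> x = real (c i) - 1"
      using "1.IH"(1)[OF IH_prems(1) 3(3) IH_prems(2) "1.prems"(2)] by blast
    have cs: "c (r - 1) = s"
      using c by (simp add: descent_columns_def)
    \<comment> \<open>The South step keeps the column, so \<open>c (r - 1)\<close> is already
      \<open>s\<close>; the only new comparison is the one at \<open>i = r - 1\<close>.\<close>
    let ?c = "c(r := s)"
    have "descent_columns T r s ?c"
      unfolding descent_columns_def
    proof (intro conjI allI impI)
      fix i assume "1 \<le> i \<and> i < r"
      then consider "1 \<le> i" "i < r - 1" | "i = r - 1" "Suc i = r"
        by linarith
      then have "1 \<le> ?c i \<and> ?c i \<le> ?c (Suc i) \<and> (2 \<le> ?c i \<longrightarrow> T (Suc i, ?c i - 1) < T (i, ?c i)) \<and>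
        (\<forall>j. ?c i \<le> j \<and> j < ?c (Suc i) \<longrightarrow> T (i, Suc j) \<le> T (Suc i, j))"
      proof cases
        case 1
        then have "Suc i \<noteq> r" "i \<noteq> r"
          by linarith+
        with 1 show ?thesis
          using c by (simp add: descent_columns_def)
      next
        case 2
        then show ?thesis
          using 3 cs by auto
      qed
      then show "1 \<le> ?c i" "?c i \<le> ?c (Suc i)"
        "2 \<le> ?c i \<Longrightarrow> T (Suc i, ?c i - 1) < T (i, ?c i)"
        "\<And>j. ?c i \<le> j \<and> j < ?c (Suc i) \<Longrightarrow> T (i, Suc j) \<le> T (Suc i, j)"
        by blast+
    qed simp
    moreover have "(x, real i - 1 / 2) \<in> polyline (path_vertices T r s) \<longleftrightarrow> x = real (?c i) - 1"
      if "1 \<le> i" "i < r" for i x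
    proof (cases "i = r - 1")
      case True
      then have "(x, real i - 1 / 2) \<notin> polyline (path_vertices T (r - 1) s)"
        using polyline_path_vertices_le[OF IH_prems(2) "1.prems"(2), of x "real i - 1 / 2" T] 3 by auto
      with True 3 cs show ?thesis
        by (auto simp: poly corner_def mem_vertical_segment_iff)
    next
      case False
      with that have "i < r - 1"
        by linarith
      then have "real i + 1 \<le> real (r - 1)"
        by linarith
      then have "(x, real i - 1 / 2) \<notin> closed_segment (corner r s) (corner (r - 1) s)"
        by (auto simp: corner_def mem_vertical_segment_iff)
      with \<open>i < r - 1\<close> that cross show ?thesis
        by (simp add: poly)
    qed
    ultimately show ?thesis
      by blast
  next
    case 4
    obtain ps where ps: "path_vertices T r (s - 1) = corner r (s - 1) # ps"
      using path_vertices_eq_Cons by blast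
    have "path_vertices T r s = corner r s # path_vertices T r (s - 1)"
      using 4 by (subst path_vertices.simps) simp
    then have poly: "polyline (path_vertices T r s) =
        closed_segment (corner r s) (corner r (s - 1)) \<union> polyline (path_vertices T r (s - 1))"
      by (simp only: ps polyline_Cons_Cons)
    have IH_prems: "\<not> (r \<le> 1 \<or> s \<le> 1)" "1 \<le> s - 1"
      using 4 by linarith+
    obtain c where c: "descent_columns T r (s - 1) c"
      and cross: "\<And>i x. 1 \<le> i \<Longrightarrow> i < r \<Longrightarrow>
        (x, real i - 1 / 2) \<in> polyline (path_vertices T r (s - 1)) \<longleftrightarrow> x = real (c i) - 1"
      using "1.IH"(2)[OF IH_prems(1) 4(3) "1.prems"(1) IH_prems(2)] by blast
    have cs: "c r = s - 1"
      using c by (simp add: descent_columns_def)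
    let ?c = "c(r := s)"
    have "descent_columns T r s ?c"
      unfolding descent_columns_def
    proof (intro conjI allI impI)
      fix i assume i: "1 \<le> i \<and> i < r"
      then have ci: "1 \<le> c i \<and> c i \<le> c (Suc i) \<and> (2 \<le> c i \<longrightarrow> T (Suc i, c i - 1) < T (i, c i)) \<and>
        (\<forall>j. c i \<le> j \<and> j < c (Suc i) \<longrightarrow> T (i, Suc j) \<le> T (Suc i, j))"
        using c by (simp add: descent_columns_def)
      then show "1 \<le> ?c i" "2 \<le> ?c i \<Longrightarrow> T (Suc i, ?c i - 1) < T (i, ?c i)"
        using i by auto
      show "?c i \<le> ?c (Suc i)"
        using i ci cs by auto
      show "T (i, Suc j) \<le> T (Suc i, j)" if j: "?c i \<le> j \<and> j < ?c (Suc i)" for j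
      \<comment> \<open>The pair \<open>i = r - 1\<close>, \<open>j = s - 1\<close> is the West step
        just taken; all other pairs are inherited.\<close>
      proof (cases "Suc i = r \<and> j = s - 1")
        case True
        then have "i = r - 1" "Suc j = s"
          using 4 by auto
        with True 4 show ?thesis
          by auto
      next
        case False
        then have "c i \<le> j" "j < c (Suc i)"
          using i j cs by (auto split: if_splits)
        with ci show ?thesis
          by blast
      qed
    qed simp
    moreover have "(x, real i - 1 / 2) \<in> polyline (path_vertices T r s) \<longleftrightarrow> x = real (?c i) - 1"
      if "1 \<le> i" "i < r" for i x
    proof -
      have "(x, real i - 1 / 2) \<notin> closed_segment (corner r s) (corner r (s - 1))"
      proof
        assume "(x, real i - 1 / 2) \<in> closed_segment (corner r s) (corner r (s - 1))"
        then have "real i - 1 / 2 = real r - 1"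
          unfolding corner_def by (rule horizontal_segment_snd)
        moreover have "real i + 1 \<le> real r"
          using that by linarith
        ultimately show False
          by linarith
      qed
      with that cross show ?thesis
        by (simp add: poly)
    qed
    ultimately show ?thesis
      by blast
  qed
qed

lemma descent_columns_mono:
  assumes "descent_columns T r s c" "1 \<le> i" "i \<le> i'" "i' \<le> r"
  shows "c i \<le> c i'"
  using assms(3,4)
proof (induction i' rule: dec_induct)
  case (step n)
  then show ?case
    using assms(1,2) unfolding descent_columns_def
    by (meson Suc_le_lessD le_trans less_imp_le_nat)
qed simp

section \<open>Blocks of contents, and where the shift preserves their order\<close>

section \<open>The cyclic shift of contents\<close>

text \<open>A block has only its first content on the side of (1, 1), so no block can start strictly
  inside another. With a common start, maximality makes the lengths agree.\<close>

lemma block_unique: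
  assumes "block la T k a m" "block la T k a' m'"
    and "a \<le> d" "d \<le> a + m" "a' \<le> d" "d \<le> a' + m'"
  shows "a = a' \<and> m = m'"
proof -
  have r: "run la T k a m" "run la T k a' m'"
    using assms by (auto simp: block_def)
  have "\<not> a < a'"
  proof
    assume "a < a'"
    then have "a' - a \<in> {1..m}"
      using assms by auto
    then have "\<not> same_side la T k (a + (a' - a))"
      using r(1) unfolding run_def by blast
    with \<open>a < a'\<close> r(2) show False
      by (simp add: run_def)
  qed
  moreover have "\<not> a' < a"
  proof
    assume "a' < a"
    then have "a - a' \<in> {1..m'}"
      using assms by auto
    then have "\<not> same_side la T k (a' + (a - a'))"
      using r(2) unfolding run_def by blast
    with \<open>a' < a\<close> r(1) show False
      by (simp add: run_def)
  qed
  ultimately have "a = a'"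
    by simp
  with assms r show ?thesis
    by (auto simp: block_def intro: antisym)
qed

lemma ex_block:
  assumes "run la T k a m"
  shows "\<exists>m'\<ge>m. block la T k a m'"
proof -
  have "finite {m. run la T k a m}"
    by (rule finite_subset[of _ "{..k}"]) (auto simp: run_def)
  moreover from this have "run la T k a (Max {m. run la T k a m})"
    using Max_in[of "{m. run la T k a m}"] assms by auto
  ultimately show ?thesis
    using assms by (intro exI[of _ "Max {m. run la T k a m}"]) (auto simp: block_def)
qed

lemma new_content_eq:
  assumes "block la T k a m"
    and "d = a \<and> e = a + m \<or> (\<exists>l \<in> {1..m}. d = a + l \<and> e = a + l - 1)"
  shows "new_content la T k d = e"
  unfolding new_content_def
proof (rule the_equality)
  show "\<exists>a m. block la T k a m \<and> (d = a \<and> e = a + m \<or> (\<exists>l \<in> {1..m}. d = a + l \<and> e = a + l - 1))"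
    using assms by blast
next
  fix e'
  assume "\<exists>a m. block la T k a m \<and>
    (d = a \<and> e' = a + m \<or> (\<exists>l \<in> {1..m}. d = a + l \<and> e' = a + l - 1))"
  then obtain a' m' where *: "block la T k a' m'"
      "d = a' \<and> e' = a' + m' \<or> (\<exists>l \<in> {1..m'}. d = a' + l \<and> e' = a' + l - 1)"
    by blast
  have "a = a' \<and> m = m'"
    using block_unique[OF assms(1) *(1), of d] assms(2) *(2) by auto
  with assms(2) *(2) show "e' = e"
    by auto
qed

text \<open>Here \<open>d\<close> opens a block, with \<open>m\<close> further contents. The last
  fact is maximality of that block, which is what injectivity of the shift rests on.\<close>

lemma new_content_same_side:
  assumes "1 \<le> d" "d < k" "same_side la T k d"
  obtains m where "new_content la T k d = d + m" "d + m < k"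
    "\<And>e. d < e \<Longrightarrow> e \<le> d + m \<Longrightarrow> \<not> same_side la T k e"
    "d + m + 1 < k \<Longrightarrow> same_side la T k (d + m + 1)"
proof -
  have "run la T k d 0"
    using assms by (simp add: run_def)
  then obtain m where m: "block la T k d m"
    using ex_block by blast
  then have r: "run la T k d m"
    by (simp add: block_def)
  show thesis
  proof
    show "new_content la T k d = d + m"
      using m by (rule new_content_eq) simp
    show "d + m < k"
      using r by (simp add: run_def)
    show "\<not> same_side la T k e" if "d < e" "e \<le> d + m" for e
    proof -
      have "e - d \<in> {1..m}"
        using that by auto
      then have "\<not> same_side la T k (d + (e - d))"
        using r unfolding run_def by blast
      with that show ?thesis
        by simp
    qed
    show "same_side la T k (d + m + 1)" if "d + m + 1 < k"
    proof (rule ccontr)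
      assume "\<not> same_side la T k (d + m + 1)"
      with r that have "run la T k d (m + 1)"
        by (auto simp: run_def atLeastAtMostSuc_conv)
      with m show False
        by (auto simp: block_def)
    qed
  qed
qed

text \<open>As content 1 is on the side of (1, 1), there is a last content \<open>a\<close> of that
  side before \<open>d\<close>. Then \<open>d\<close> lies in the block opened by \<open>a\<close>,
  past its start.\<close>

lemma new_content_other_side:
  assumes "same_side la T k 1" "1 \<le> d" "d < k" "\<not> same_side la T k d"
  shows "new_content la T k d = d - 1" "2 \<le> d"
proof -
  define a where "a = (GREATEST a. 1 \<le> a \<and> a \<le> d \<and> same_side la T k a)"
  have a: "1 \<le> a \<and> a \<le> d \<and> same_side la T k a"
    unfolding a_def by (rule GreatestI_nat[of _ 1 d]) (use assms in auto)
  have max: "e \<le> a" if "1 \<le> e" "e \<le> d" "same_side la T k e" for e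
    unfolding a_def by (rule Greatest_le_nat[of _ _ d]) (use that in auto)
  have "a \<noteq> d"
    using a assms by auto
  with a have "a < d"
    by simp
  have "\<not> same_side la T k (a + l)" if "l \<in> {1..d - a}" for l
    using max[of "a + l"] that \<open>a < d\<close> by force
  then have "run la T k a (d - a)"
    using a \<open>a < d\<close> assms by (auto simp: run_def)
  then obtain m where m: "d - a \<le> m" "block la T k a m"
    using ex_block by blast
  show "new_content la T k d = d - 1"
    using m(2) by (rule new_content_eq) (use m(1) \<open>a < d\<close> in \<open>auto intro!: bexI[of _ "d - a"]\<close>)
  show "2 \<le> d"
    using \<open>a < d\<close> a by linarith
qed

lemma new_content_range:
  assumes "same_side la T k 1" "1 \<le> d" "d < k"
  shows "1 \<le> new_content la T k d \<and> new_content la T k d < k"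
proof (cases "same_side la T k d")
  case True
  with assms obtain m where "new_content la T k d = d + m" "d + m < k"
    using new_content_same_side[of d k la T] by metis
  with assms show ?thesis
    by simp
next
  case False
  with assms show ?thesis
    using new_content_other_side[of la T k d] by auto
qed

text \<open>Contents on the side of (1, 1) move up, but never as far as the next content of that
  side; the others drop by one. So order can fail only if \<open>d\<close> opens the block that
  contains \<open>e\<close>, which the last hypothesis excludes.\<close>

lemma new_content_strict_mono:
  assumes "same_side la T k 1" "1 \<le> d" "d < e" "e < k"
    and "same_side la T k d \<Longrightarrow> \<not> same_side la T k e \<Longrightarrow> \<exists>f. d < f \<and> f < e \<and> same_side la T k f"
  shows "new_content la T k d < new_content la T k e"
proof (cases "same_side la T k d")
  case True
  obtain m where m: "new_content la T k d = d + m"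
      "\<And>f. d < f \<Longrightarrow> f \<le> d + m \<Longrightarrow> \<not> same_side la T k f"
    using new_content_same_side[of d k la T] True assms by (metis less_trans)
  show ?thesis
  proof (cases "same_side la T k e")
    case e: True
    have "d + m < e"
      using m(2)[of e] e assms by force
    moreover have "e \<le> new_content la T k e"
      using e assms new_content_same_side[of e k la T] by (metis le_add1 le_trans less_imp_le_nat)
    ultimately show ?thesis
      using m by simp
  next
    case e: False
    then obtain f where f: "d < f" "f < e" "same_side la T k f"
      using assms True by blast
    \<comment> \<open>The block of \<open>d\<close> ends before \<open>f\<close>, and
      \<open>f \<le> e - 1\<close>, the new value of \<open>e\<close>.\<close>
    then have "d + m < f"
      using m(2)[of f] by force
    then show ?thesis
      using m f new_content_other_side[of la T k e] e assms by simp
  qed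
next
  case False
  then have d: "new_content la T k d = d - 1" "2 \<le> d"
    using new_content_other_side[of la T k d] assms by auto
  show ?thesis
  proof (cases "same_side la T k e")
    case e: True
    have "e \<le> new_content la T k e"
      using e assms new_content_same_side[of e k la T] by (metis le_add1 le_trans less_imp_le_nat)
    then show ?thesis
      using d assms by simp
  next
    case e: False
    then show ?thesis
      using d new_content_other_side[of la T k e] assms by simp
  qed
qed

text \<open>In the one case without monotonicity, equal values would force
  \<open>e = d + m + 1\<close>, the content right after the block of \<open>d\<close>. By maximality
  that content is on the side of (1, 1), unlike \<open>e\<close>.\<close>

lemma new_content_neq:
  assumes "same_side la T k 1" "1 \<le> d" "d < e" "e < k"
  shows "new_content la T k d \<noteq> new_content la T k e"
proof (cases "same_side la T k d \<and> \<not> same_side la T k e")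
  case True
  then obtain m where m: "new_content la T k d = d + m"
      "d + m + 1 < k \<Longrightarrow> same_side la T k (d + m + 1)"
    using new_content_same_side[of d k la T] assms by (metis less_trans)
  have e: "new_content la T k e = e - 1"
    using new_content_other_side[of la T k e] True assms by auto
  show ?thesis
  proof
    assume "new_content la T k d = new_content la T k e"
    then have "e = d + m + 1"
      using m e assms by linarith
    with m(2) True assms show False
      by blast
  qed
next
  case False
  then have "new_content la T k d < new_content la T k e"
    using assms by (intro new_content_strict_mono) auto
  then show ?thesis
    by simp
qed

section \<open>Monotonicity on the diagram, separating contents, and the conclusion\<close>

section \<open>Standardness of the image\<close>

lemma diagram_down_closed:
  assumes "partition_of n la" "(i, j) \<in> diagram la" "1 \<le> i'" "i' \<le> i" "1 \<le> j'" "j' \<le> j"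
  shows "(i', j') \<in> diagram la"
proof -
  have "la ! (i - 1) \<le> la ! (i' - 1)"
  proof (cases "i' = i")
    case False
    have "sorted_wrt (\<ge>) la"
      using assms by (simp add: partition_of_def)
    then show ?thesis
      by (rule sorted_wrt_nth_less) (use assms False in \<open>auto simp: diagram_def\<close>)
  qed simp
  with assms show ?thesis
    by (auto simp: diagram_def)
qed

lemma SYT_mono:
  assumes "partition_of n la" "T \<in> SYT la"
    and "(i, j) \<in> diagram la" "(i', j') \<in> diagram la" "i \<le> i'" "j \<le> j'"
  shows "T (i, j) \<le> T (i', j')"
proof -
  have d: "(i, j') \<in> diagram la"
    using assms(1,4) by (rule diagram_down_closed) (use assms in \<open>auto simp: diagram_def\<close>)
  have "T (i, j) \<le> T (i, j')"
    using assms d by (cases "j = j'") (auto simp: SYT_def intro: less_imp_le)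
  also have "\<dots> \<le> T (i', j')"
    using assms d by (cases "i = i'") (auto simp: SYT_def intro: less_imp_le)
  finally show ?thesis .
qed

text \<open>A discrete intermediate value principle. With \<open>f = c\<close> it finds the row at
  which a column passes from below the path to above it.\<close>

lemma ex_crossing_index:
  fixes f :: "nat \<Rightarrow> nat"
  assumes "a \<le> b" "f a \<le> j" "j < f b"
  shows "\<exists>i. a \<le> i \<and> i < b \<and> f i \<le> j \<and> j < f (Suc i)"
  using assms
proof (induction b rule: dec_induct)
  case (step n)
  then show ?case
    by (cases "j < f n") (auto intro: less_SucI simp: not_less)
qed simp

theorem theorem4:
  fixes la :: "nat list" and n k :: nat and T :: "nat \<times> nat \<Rightarrow> nat"
  assumes "partition_of n la"
    and "3 \<le> k" and "k \<le> n"
    and "T \<in> SYT la"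
  shows "Psi la k T \<in> SYT la"
proof -
  let ?D = "diagram la"
  have sum: "sum_list la = n"
    using assms(1) by (simp add: partition_of_def)
  have bij: "bij_betw T ?D {1..n}" and ext: "T \<in> extensional ?D"
    and rows: "\<And>i j j'. (i, j) \<in> ?D \<Longrightarrow> (i, j') \<in> ?D \<Longrightarrow> j < j' \<Longrightarrow> T (i, j) < T (i, j')"
    and cols: "\<And>i i' j. (i, j) \<in> ?D \<Longrightarrow> (i', j) \<in> ?D \<Longrightarrow> i < i' \<Longrightarrow> T (i, j) < T (i', j)"
    using assms(4) by (auto simp: SYT_def sum)
  have inj: "inj_on T ?D" and im: "T ` ?D = {1..n}"
    using bij by (auto simp: bij_betw_def)
  have down: "(i', j') \<in> ?D" if "(i, j) \<in> ?D" "1 \<le> i'" "i' \<le> i" "1 \<le> j'" "j' \<le> j" for i j i' j'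
    using diagram_down_closed[OF assms(1)] that by blast
  have mono: "T (i, j) \<le> T (i', j')"
    if "(i, j) \<in> ?D" "(i', j') \<in> ?D" "i \<le> i'" "j \<le> j'" for i j i' j'
    using SYT_mono[OF assms(1,4)] that by blast
  have cell_T: "cell_of la T (T p) = p" if "p \<in> ?D" for p
    using that inj by (simp add: cell_of_def the_inv_into_f_f)
  have pos: "1 \<le> i \<and> 1 \<le> j" if "(i, j) \<in> ?D" for i j
    using that by (simp add: diagram_def)

  have "k \<in> T ` ?D"
    using im assms by auto
  then obtain r s where rs: "(r, s) \<in> ?D" "T (r, s) = k"
    by auto
  then have cell_k: "cell_of la T k = (r, s)"
    using cell_T by blast
  \<comment> \<open>Content 1 must be located at (1, 1): this makes 1 the start of a block, so every
    smaller-than-\<open>k\<close> content belongs to some block.\<close>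
  have "1 \<in> T ` ?D"
    using im assms by auto
  then obtain i1 j1 where ij1: "(i1, j1) \<in> ?D" "T (i1, j1) = 1"
    by auto
  have D11: "(1, 1) \<in> ?D"
    by (rule down[OF ij1(1)]) (use pos[OF ij1(1)] in auto)
  have "T (1, 1) \<le> 1"
    using mono[OF D11 ij1(1)] pos[OF ij1(1)] ij1(2) by simp
  moreover have "T (1, 1) \<in> {1..n}"
    using D11 im by blast
  ultimately have "T (1, 1) = 1"
    by simp
  then have "cell_of la T 1 = (1, 1)"
    using cell_T[OF D11] by simp
  then have one: "same_side la T k 1"
    by (simp add: same_side_def)

  obtain c where c: "descent_columns T r s c"
    and cross: "\<And>i x. 1 \<le> i \<Longrightarrow> i < r \<Longrightarrow>
      (x, real i - 1 / 2) \<in> polyline (path_vertices T r s) \<longleftrightarrow> x = real (c i) - 1"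
    using ex_descent_columns[of r s T] pos[OF rs(1)] by auto
  have crossing: "crossing la T k i = real (c i) - 1" if "1 \<le> i" "i < r" for i
    unfolding crossing_def tableau_path_def cell_k using cross that by simp
  \<comment> \<open>The crossing is at the left edge of column \<open>c i\<close>, so the cell in
    column \<open>c i\<close> itself already counts as below.\<close>
  have below: "below_path la T k (i, j) \<longleftrightarrow> i < r \<and> c i \<le> j" if "1 \<le> i" for i j
  proof (cases "i < r")
    case True
    have "real j - 1 / 2 > real (c i) - 1 \<longleftrightarrow> c i \<le> j"
      by linarith
    with True that show ?thesis
      by (auto simp: below_path_def cell_k crossing)
  qed (use that in \<open>auto simp: below_path_def cell_k\<close>)
  have c_step: "T (Suc i, c i - 1) < T (i, c i)" if "1 \<le> i" "i < r" "2 \<le> c i" for i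
    using c that by (simp add: descent_columns_def)
  have c_west: "T (i, Suc j) \<le> T (Suc i, j)" if "1 \<le> i" "i < r" "c i \<le> j" "j < c (Suc i)" for i j
    using c that by (simp add: descent_columns_def)
  have c_mono: "c i \<le> c i'" if "1 \<le> i" "i \<le> i'" "i' \<le> r" for i i'
    using descent_columns_mono[OF c] that by blast
  have cr: "c r = s"
    using c by (simp add: descent_columns_def)

  have row_sep: "\<exists>z \<in> ?D. T (i, j) < T z \<and> T z < T (i, j') \<and> below_path la T k z = below_path la T k (i, j)"
    if ij: "(i, j) \<in> ?D" "(i, j') \<in> ?D" "j < j'"
      and sides: "below_path la T k (i, j) \<noteq> below_path la T k (i, j')" for i j j'
  proof -
    have i: "1 \<le> i" and j: "1 \<le> j"
      using pos ij by auto
    \<comment> \<open>Going right in a row one can only pass from above the path to below it, so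
      \<open>(i, j)\<close> is the cell above.\<close>
    have r: "i < r" "j < c i" "c i \<le> j'"
      using sides ij(3) by (auto simp: below[OF i])
    have "c i \<le> s"
      using c_mono[of i r] i r cr by simp
    \<comment> \<open>The separating cell lies in the rectangle spanned by (1, 1) and (r, s), hence
      in the diagram.\<close>
    have z: "(Suc i, c i - 1) \<in> ?D"
      by (rule down[OF rs(1)]) (use r j \<open>c i \<le> s\<close> in auto)
    have l: "(i, c i - 1) \<in> ?D" and u: "(i, c i) \<in> ?D"
      by (rule down[OF ij(2)]; use i j r in auto)+
    have "T (i, j) \<le> T (i, c i - 1)"
      using mono[OF ij(1) l] r by simp
    also have "\<dots> < T (Suc i, c i - 1)"
      using cols[OF l z] by simp
    finally have 1: "T (i, j) < T (Suc i, c i - 1)" .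
    have "T (Suc i, c i - 1) < T (i, c i)"
      using c_step i j r by simp
    also have "\<dots> \<le> T (i, j')"
      using mono[OF u ij(2)] r by simp
    finally have 2: "T (Suc i, c i - 1) < T (i, j')" .
    \<comment> \<open>Either \<open>Suc i = r\<close>, where every cell counts as above, or
      \<open>c i - 1 < c i \<le> c (Suc i)\<close>.\<close>
    have "\<not> below_path la T k (Suc i, c i - 1)"
      using c_mono[of i "Suc i"] i j r by (auto simp: below)
    moreover have "\<not> below_path la T k (i, j)"
      using r i by (simp add: below)
    ultimately show ?thesis
      using z 1 2 by blast
  qed

  have col_sep: "\<exists>z \<in> ?D. T (i, j) < T z \<and> T z < T (i', j) \<and> below_path la T k z = below_path la T k (i, j)"
    if ij: "(i, j) \<in> ?D" "(i', j) \<in> ?D" "i < i'" "T (i', j) < k"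
      and sides: "below_path la T k (i, j) \<noteq> below_path la T k (i', j)" for i i' j
  proof -
    have i: "1 \<le> i" "1 \<le> i'" and j: "1 \<le> j"
      using pos ij by auto
    have ir: "i < r" "c i \<le> j" and above: "r \<le> i' \<or> j < c i'"
      using sides ij(3) i c_mono[of i i'] by (auto simp: below)
    \<comment> \<open>The columns \<open>c\<close> describe the path only up to row
      \<open>r\<close>. If \<open>i'\<close> is at least \<open>r\<close>, the content of
      \<open>(i', j)\<close> being less than \<open>k\<close> forces
      \<open>j < s = c r\<close>.\<close>
    have "j < c (min i' r)"
    proof (cases "r \<le> i'")
      case True
      have "j < s"
      proof (rule ccontr)
        assume "\<not> j < s"
        then have "k \<le> T (i', j)"
          using mono[OF rs(1) ij(2)] True rs(2) by simp
        with ij(4) show False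
          by simp
      qed
      with True cr show ?thesis
        by (simp add: min_def)
    next
      case False
      with above show ?thesis
        by (simp add: min_def)
    qed
    then obtain i0 where i0: "i \<le> i0" "i0 < min i' r" "c i0 \<le> j" "j < c (Suc i0)"
      using ex_crossing_index[of i "min i' r" c j] ij(3) ir by auto
    have "c (Suc i0) \<le> s"
      using c_mono[of "Suc i0" r] i0 cr by simp
    have z: "(i0, Suc j) \<in> ?D"
      by (rule down[OF rs(1)]) (use i i0 \<open>c (Suc i0) \<le> s\<close> in auto)
    have l: "(i0, j) \<in> ?D" and u: "(Suc i0, j) \<in> ?D"
      by (rule down[OF ij(2)]; use i j i0 in auto)+
    have "T (i, j) \<le> T (i0, j)"
      using mono[OF ij(1) l] i0 by simp
    also have "\<dots> < T (i0, Suc j)"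
      using rows[OF l z] by simp
    finally have 1: "T (i, j) < T (i0, Suc j)" .
    have "T (i0, Suc j) \<le> T (Suc i0, j)"
      using c_west i i0 by simp
    \<comment> \<open>The West branch yields only a weak inequality; injectivity of \<open>T\<close>
      makes it strict.\<close>
    moreover have "T (i0, Suc j) \<noteq> T (Suc i0, j)"
      using inj_onD[OF inj _ z u] by auto
    ultimately have "T (i0, Suc j) < T (Suc i0, j)"
      by simp
    also have "\<dots> \<le> T (i', j)"
      using mono[OF u ij(2)] i0 by simp
    finally have 2: "T (i0, Suc j) < T (i', j)" .
    have "below_path la T k (i0, Suc j)" "below_path la T k (i, j)"
      using i i0 ir by (auto simp: below)
    then show ?thesis
      using z 1 2 by blast
  qed

  \<comment> \<open>On the diagram the map acts on contents alone, so bijectivity reduces to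
    \<open>f\<close> being an injection of the finite set \<open>{1..n}\<close> into itself.\<close>
  define f where "f d = (if d < k then new_content la T k d else d)" for d
  have Psi: "Psi la k T p = f (T p)" if "p \<in> ?D" for p
    using that by (simp add: Psi_def f_def)
  have range: "1 \<le> new_content la T k d \<and> new_content la T k d < k" if "1 \<le> d" "d < k" for d
    using new_content_range[OF one] that by blast
  have "inj_on f {1..n}"
  proof (rule linorder_inj_onI)
    fix d e assume de: "d < e" "d \<in> {1..n}" "e \<in> {1..n}"
    then show "f d \<noteq> f e"
      using new_content_neq[OF one, of d e] range[of d] by (auto simp: f_def)
  qed auto
  moreover have "f d \<in> {1..n}" if "d \<in> {1..n}" for d
    using range[of d] that assms(3) by (auto simp: f_def)
  ultimately have "bij_betw f {1..n} {1..n}"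
    by (simp add: bij_betw_def endo_inj_surj image_subset_iff)
  with bij have "bij_betw (f \<circ> T) ?D {1..n}"
    by (rule bij_betw_trans)
  then have bij_Psi: "bij_betw (Psi la k T) ?D {1..n}"
    by (rule bij_betw_cong[THEN iffD1, rotated]) (simp add: Psi)

  \<comment> \<open>The separation hypothesis does not mention which side (1, 1) is on, so
    \<open>row_sep\<close> and \<open>col_sep\<close> both fit it; it is invoked only when
    \<open>p\<close> is on the side of (1, 1) and \<open>q\<close> is not.\<close>
  have Psi_less: "Psi la k T p < Psi la k T q"
    if pq: "p \<in> ?D" "q \<in> ?D" "T p < T q"
      and sep: "T q < k \<Longrightarrow> below_path la T k p \<noteq> below_path la T k q \<Longrightarrow>
        \<exists>z \<in> ?D. T p < T z \<and> T z < T q \<and> below_path la T k z = below_path la T k p" for p q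
  proof -
    have "T p \<in> {1..n}"
      using im pq by blast
    then have p1: "1 \<le> T p"
      by simp
    show ?thesis
    proof (cases "T q < k")
      case True
      have side: "same_side la T k (T z) \<longleftrightarrow> below_path la T k z = below_path la T k (1, 1)"
        if "z \<in> ?D" for z
        using that by (simp add: same_side_def cell_T)
      have "new_content la T k (T p) < new_content la T k (T q)"
      proof (rule new_content_strict_mono[OF one p1 pq(3) True])
        assume "same_side la T k (T p)" "\<not> same_side la T k (T q)"
        then have "below_path la T k p = below_path la T k (1, 1)"
          "below_path la T k p \<noteq> below_path la T k q"
          using side pq by auto
        with sep[OF True] side show "\<exists>d. T p < d \<and> d < T q \<and> same_side la T k d"
          by metis
      qed
      with True pq show ?thesis
        by (simp add: Psi f_def)
    next
      \<comment> \<open>The content of \<open>q\<close> is unchanged and at least \<open>k\<close>,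
        while a content less than \<open>k\<close> stays less than \<open>k\<close>.\<close>
      case False
      then show ?thesis
        using range[OF p1] pq by (auto simp: Psi f_def)
    qed
  qed

  have "Psi la k T \<in> extensional ?D"
    using ext by (simp add: extensional_def Psi_def)
  moreover have "Psi la k T (i, j) < Psi la k T (i, j')"
    if "(i, j) \<in> ?D" "(i, j') \<in> ?D" "j < j'" for i j j'
    using Psi_less[OF that(1,2) rows[OF that]] row_sep[OF that] by blast
  moreover have "Psi la k T (i, j) < Psi la k T (i', j)"
    if "(i, j) \<in> ?D" "(i', j) \<in> ?D" "i < i'" for i i' j
    using Psi_less[OF that(1,2) cols[OF that]] col_sep[OF that] by blast
  ultimately show ?thesis
    using bij_Psi by (auto simp: SYT_def sum)
qed

end
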